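(* Let $(X,d,\mu)$ be a metric measure space, let $p(\cdot)\in\mathcal{P}(X)$ with $p^{+}<+\infty$, and let $\varphi:X\to X$ be a non-singular Borel measurable map. Then the following statements are equivalent: (M1) There exists a constant $C>0$ such that $$\int_{X}|f(\varphi(x))|^{p(x)}\,d\mu(x)\le C\int_{X}|f(x)|^{p(x)}\,d\mu(x)\quad\text{for all } f\in L^{p(\cdot)}(X).$$ (M2) The function $u_{\varphi}$ is essentially bounded on $X$, and $p(x)=p(\varphi(x))$ for $\mu$-a.e. $x\in X$.
   Context: $(X,d,\mu)$ is a metric space with a Borel regular measure $\mu$ such that every nonempty open set has positive measure and every bounded set has finite measure. $\mathcal{P}(X)$ is the set of Borel measurable functions $p:X\to[1,\infty)$; $p^{+}=\operatorname{ess\,sup}_{X}p$. $L^{p(\cdot)}(X)$ is the set of measurable functions $f$ on $X$ such that $\rho(f/\eta)<\infty$ for some $\eta>0$, where $\rho(f)=\int_X|f(x)|^{p(x)}\,d\mu(x)$; it is normed by $\|f\|_{p(\cdot)}=\inf\{\eta>0:\rho(f/\eta)\le1\}$. The map $\varphi$ is non-singular if $\mu(\varphi^{-1}(E))=0$ for every Borel set $E$ with $\mu(E)=0$. In that case $u_\varphi\ge0$ denotes the Radon–Nikodym derivative of $\mu\circ\varphi^{-1}$ with respect to $\mu$, i.e. $\mu(\varphi^{-1}(E))=\int_E u_\varphi\,d\mu$ for every Borel set $E\subset X$. *)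

theory Defs
  imports "HOL-Probability.Essential_Supremum" "HOL-Probability.Conditional_Expectation"
begin

text \<open>
  The \<open>\<sigma>\<close>-algebra of \<open>M\<close> may be larger than the Borel one, e.g. that of the sets that are
  Caratheodory measurable for a Borel regular outer measure; \<open>sets M = sets borel\<close> is also allowed.
\<close>

definition metric_measure_space :: "'a::metric_space measure \<Rightarrow> bool" where
  "metric_measure_space M \<longleftrightarrow>
     space M = UNIV \<and>
     sets borel \<subseteq> sets M \<and>
     (\<forall>A\<in>sets M. \<exists>B\<in>sets borel. A \<subseteq> B \<and> emeasure M B = emeasure M A) \<and>
     (\<forall>U. open U \<and> U \<noteq> {} \<longrightarrow> emeasure M U > 0) \<and>
     (\<forall>A\<in>sets M. bounded A \<longrightarrow> emeasure M A < \<infinity>)"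

definition exponents :: "('a::metric_space \<Rightarrow> real) set" where
  "exponents = {p \<in> borel_measurable borel. \<forall>x. 1 \<le> p x}"

definition exponent_sup :: "'a measure \<Rightarrow> ('a \<Rightarrow> real) \<Rightarrow> ereal" where
  "exponent_sup M p = esssup M (\<lambda>x. ereal (p x))"

definition modular :: "'a measure \<Rightarrow> ('a \<Rightarrow> real) \<Rightarrow> ('a \<Rightarrow> real) \<Rightarrow> ennreal" where
  "modular M p f = (\<integral>\<^sup>+ x. ennreal (\<bar>f x\<bar> powr p x) \<partial>M)"

definition Lp_var :: "'a measure \<Rightarrow> ('a \<Rightarrow> real) \<Rightarrow> ('a \<Rightarrow> real) set" where
  "Lp_var M p = {f \<in> borel_measurable M. \<exists>\<eta>>0. modular M p (\<lambda>x. f x / \<eta>) < \<infinity>}"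

definition nonsingular_map :: "'a::metric_space measure \<Rightarrow> ('a \<Rightarrow> 'a) \<Rightarrow> bool" where
  "nonsingular_map M \<phi> \<longleftrightarrow> (\<forall>E\<in>sets borel. emeasure M E = 0 \<longrightarrow> emeasure M (\<phi> -` E) = 0)"

text \<open>
  Both measures live on the Borel sets, since \<open>\<phi>\<close> is only assumed to be Borel measurable.
  The derivative may take the value \<open>\<infinity>\<close>: the image measure need not be \<open>\<sigma>\<close>-finite.
\<close>

definition map_density :: "'a::metric_space measure \<Rightarrow> ('a \<Rightarrow> 'a) \<Rightarrow> 'a \<Rightarrow> ennreal" where
  "map_density M \<phi> = RN_deriv (restr_to_subalg M borel) (distr M borel \<phi>)"

lemma metric_measure_space_subalgebra:
  assumes "metric_measure_space M"
  shows "subalgebra M borel"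
  using assms by (simp add: metric_measure_space_def subalgebra_def)

lemma metric_measure_space_sigma_finite:
  fixes M :: "'a::metric_space measure"
  assumes M: "metric_measure_space M"
  shows "sigma_finite_measure (restr_to_subalg M borel)"
proof
  note sub = metric_measure_space_subalgebra[OF M]
  define x0 :: 'a where "x0 = undefined"
  let ?A = "range (\<lambda>n::nat. ball x0 (real n))"
  have "(\<Union>n::nat. ball x0 (real n)) = UNIV"
    by (auto simp: reals_Archimedean2)
  moreover have "emeasure (restr_to_subalg M borel) (ball x0 (real n)) \<noteq> \<infinity>" for n
  proof -
    have "ball x0 (real n) \<in> sets M"
      using M by (auto simp: metric_measure_space_def)
    then have "emeasure M (ball x0 (real n)) < \<infinity>"
      using M unfolding metric_measure_space_def by blast
    then show ?thesis
      by (simp add: emeasure_restr_to_subalg[OF sub])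
  qed
  ultimately show "\<exists>A. countable A \<and> A \<subseteq> sets (restr_to_subalg M borel) \<and>
      \<Union> A = space (restr_to_subalg M borel) \<and>
      (\<forall>a\<in>A. emeasure (restr_to_subalg M borel) a \<noteq> \<infinity>)"
    using M by (intro exI[of _ ?A])
      (auto simp: sets_restr_to_subalg[OF sub] space_restr_to_subalg metric_measure_space_def)
qed

lemma map_density_measurable [measurable]:
  assumes "metric_measure_space M"
  shows "map_density M \<phi> \<in> borel_measurable borel"
proof -
  have "map_density M \<phi> \<in> borel_measurable (restr_to_subalg M borel)"
    unfolding map_density_def by simp
  moreover have "sets (restr_to_subalg M borel) = sets borel"
    by (rule sets_restr_to_subalg[OF metric_measure_space_subalgebra[OF assms]])
  ultimately show ?thesis
    using measurable_cong_sets by blast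
qed

lemma emeasure_vimage_eq_map_density:
  fixes M :: "'a::metric_space measure"
  assumes M: "metric_measure_space M" and \<phi>: "\<phi> \<in> borel_measurable borel"
    and ns: "nonsingular_map M \<phi>" and E: "E \<in> sets borel"
  shows "emeasure M (\<phi> -` E) = (\<integral>\<^sup>+ x\<in>E. map_density M \<phi> x \<partial>M)"
proof -
  let ?R = "restr_to_subalg M borel"
  note sub = metric_measure_space_subalgebra[OF M]
  have sp: "space M = UNIV" using M by (simp add: metric_measure_space_def)
  interpret R: sigma_finite_measure ?R
    by (rule metric_measure_space_sigma_finite[OF M])
  have [measurable]: "\<phi> \<in> measurable M borel"
    using measurable_from_subalg[OF sub \<phi>] .
  have sets: "sets ?R = sets borel" by (rule sets_restr_to_subalg[OF sub])
  have ac: "absolutely_continuous ?R (distr M borel \<phi>)"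
    unfolding absolutely_continuous_def
  proof
    fix A assume "A \<in> null_sets ?R"
    then have "A \<in> sets borel" "emeasure M A = 0"
      by (auto simp: null_sets_def sets emeasure_restr_to_subalg[OF sub])
    then show "A \<in> null_sets (distr M borel \<phi>)"
      using ns by (auto simp: null_sets_def emeasure_distr sp nonsingular_map_def)
  qed
  have dens: "density ?R (map_density M \<phi>) = distr M borel \<phi>"
    unfolding map_density_def by (rule R.density_RN_deriv[OF ac]) (simp add: sets)
  have meas: "(\<lambda>x. map_density M \<phi> x * indicator E x) \<in> borel_measurable borel"
    using E map_density_measurable[OF M] by measurable
  have "emeasure M (\<phi> -` E) = emeasure (distr M borel \<phi>) E"
    using E by (simp add: emeasure_distr sp)
  also have "\<dots> = (\<integral>\<^sup>+ x\<in>E. map_density M \<phi> x \<partial>?R)"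
    unfolding dens[symmetric] using E
    by (intro emeasure_density) (auto simp: sets map_density_def)
  also have "\<dots> = (\<integral>\<^sup>+ x\<in>E. map_density M \<phi> x \<partial>M)"
    using meas by (intro nn_integral_subalgebra2[OF sub])
  finally show ?thesis .
qed

end

theory Submission
  imports Defs
begin

text \<open>
  If \<open>p\<close> and \<open>p \<circ> \<phi>\<close> agree almost everywhere, then \<open>\<bar>f (\<phi> x)\<bar> powr p x\<close> is the function
  \<open>\<bar>f\<bar> powr p\<close> composed with \<open>\<phi>\<close>, so its integral is that of \<open>\<bar>f\<bar> powr p\<close> against the density
  \<open>u\<close> of the image measure, and an essential bound of \<open>u\<close> is an admissible constant. The one
  delicate point is that \<open>f\<close> is measurable only for the \<open>\<sigma>\<close>-algebra of \<open>M\<close>, whereas \<open>\<phi>\<close> is Borel: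
  by Borel regularity \<open>f\<close> agrees with a Borel function off a Borel null set
  (\<open>ex_borel_representative\<close>), and non-singularity pulls that set back to a null set.

  Conversely, the inequality is tested on the multiples \<open>t * indicator F\<close> with \<open>F\<close> bounded and Borel
  (\<open>test_inequality\<close>). For \<open>t = 1\<close> it says that the image measure of \<open>F\<close> is at most \<open>C\<close> times the
  measure of \<open>F\<close>, which bounds \<open>u\<close> by \<open>C\<close> almost everywhere
  (\<open>map_density_le_const\<close>). If instead \<open>p\<close> and \<open>p \<circ> \<phi>\<close> are separated by two numbers on a set \<open>A\<close> of positive measure, the left side scales in \<open>t\<close> with an exponent on one side of
  the gap and the right side with an exponent on the other; letting \<open>t\<close> tend to \<open>\<infinity>\<close> or
  to \<open>0\<close>, according to which is larger, contradicts the inequality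
  (\<open>null_set_if_exponents_separated\<close>).
\<close>

section \<open>Borel representatives\<close>

lemma metric_measure_space_borel_sets:
  "metric_measure_space M \<Longrightarrow> E \<in> sets borel \<Longrightarrow> E \<in> sets M"
  by (auto simp: metric_measure_space_def)

lemma metric_measure_space_space: "metric_measure_space M \<Longrightarrow> space M = UNIV"
  by (simp add: metric_measure_space_def)

lemma metric_measure_space_bounded_finite:
  "metric_measure_space M \<Longrightarrow> E \<in> sets borel \<Longrightarrow> bounded E \<Longrightarrow> emeasure M E < \<infinity>"
  by (auto simp: metric_measure_space_def)

text \<open>
  A measurable set of finite measure differs from its Borel hull by a null set, and that null set
  has a Borel null hull. Finiteness is needed to subtract measures, so a general set
  is cut into its bounded pieces first.
\<close>

lemma metric_measure_space_sets_completion: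
  fixes M :: "'a::metric_space measure"
  assumes M: "metric_measure_space M"
  shows "sets M \<subseteq> sets (completion (restr_to_subalg M borel))"
proof
  let ?R = "restr_to_subalg M borel"
  note sub = metric_measure_space_subalgebra[OF M]
  fix A assume A: "A \<in> sets M"
  define D where "D n = A \<inter> ball undefined (real n)" for n :: nat
  have hull: "\<exists>B\<in>sets borel. E \<subseteq> B \<and> emeasure M B = emeasure M E" if "E \<in> sets M" for E
    using M that by (auto simp: metric_measure_space_def)
  have "D n \<in> sets (completion ?R)" for n
  proof -
    have Dn: "D n \<in> sets M"
      unfolding D_def by (intro sets.Int A metric_measure_space_borel_sets[OF M]) auto
    obtain B where B: "B \<in> sets borel" "D n \<subseteq> B" "emeasure M B = emeasure M (D n)"
      using hull[OF Dn] by blast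
    have BM: "B \<in> sets M"
      using metric_measure_space_borel_sets[OF M B(1)] .
    have "emeasure M (D n) < \<infinity>"
      using M Dn unfolding metric_measure_space_def
      by (auto simp: D_def intro: bounded_subset[OF bounded_ball])
    then have "emeasure M (B - D n) = 0"
      using B Dn BM by (subst emeasure_Diff) auto
    then obtain N where N: "N \<in> sets borel" "B - D n \<subseteq> N" "emeasure M N = 0"
      using hull[of "B - D n"] Dn BM by auto
    have "N \<in> null_sets ?R"
      using N metric_measure_space_borel_sets[OF M N(1)]
      unfolding null_sets_restr_to_subalg[OF sub] by (auto simp: null_sets_def)
    then have "B - D n \<in> sets (completion ?R)"
      using N(2) by (rule null_sets_completion)
    moreover have "B \<in> sets (completion ?R)"
      using B(1) by (auto simp: sets_restr_to_subalg[OF sub])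
    moreover have "D n = B - (B - D n)"
      using B(2) by auto
    ultimately show ?thesis
      by (metis sets.Diff)
  qed
  then have "(\<Union>n. D n) \<in> sets (completion ?R)"
    by auto
  moreover have "(\<Union>n. D n) = A"
    by (auto simp: D_def reals_Archimedean2)
  ultimately show "A \<in> sets (completion ?R)"
    by simp
qed

text \<open>
  The exceptional set is asked to be Borel because it will be pulled back along \<open>\<phi>\<close>, and both the
  measurability and the non-singularity of \<open>\<phi>\<close> speak of Borel sets only.
\<close>

lemma ex_borel_representative:
  fixes M :: "'a::metric_space measure" and f :: "'a \<Rightarrow> real"
  assumes M: "metric_measure_space M" and f: "f \<in> borel_measurable M"
  obtains g N where "g \<in> borel_measurable borel" "N \<in> sets borel" "emeasure M N = 0"
    "\<And>x. x \<notin> N \<Longrightarrow> f x = g x"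
proof -
  let ?R = "restr_to_subalg M borel"
  note sub = metric_measure_space_subalgebra[OF M]
  have "f \<in> borel_measurable (completion ?R)"
    using f metric_measure_space_sets_completion[OF M]
    by (auto simp: measurable_def space_restr_to_subalg)
  then obtain g where g: "g \<in> borel_measurable ?R" "AE x in ?R. f x = g x"
    using completion_ex_borel_measurable_real by blast
  from g(2) obtain N where N: "N \<in> null_sets ?R" "{x\<in>space ?R. f x \<noteq> g x} \<subseteq> N"
    by (auto simp: eventually_ae_filter)
  show thesis
  proof
    show "g \<in> borel_measurable borel"
      using g(1) measurable_cong_sets[OF sets_restr_to_subalg[OF sub] refl] by blast
    show "N \<in> sets borel" "emeasure M N = 0"
      using N(1) by (auto simp: null_sets_restr_to_subalg[OF sub])
    show "f x = g x" if "x \<notin> N" for x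
      using N(2) that by (auto simp: space_restr_to_subalg metric_measure_space_space[OF M])
  qed
qed

section \<open>Sufficiency: change of variables\<close>

lemma nn_integral_comp_map_density:
  fixes M :: "'a::metric_space measure"
  assumes M: "metric_measure_space M" and \<phi>: "\<phi> \<in> borel_measurable borel"
    and ns: "nonsingular_map M \<phi>" and h: "h \<in> borel_measurable borel"
  shows "(\<integral>\<^sup>+ x. h (\<phi> x) \<partial>M) = (\<integral>\<^sup>+ x. map_density M \<phi> x * h x \<partial>M)"
proof -
  note sub = metric_measure_space_subalgebra[OF M]
  have [measurable]: "\<phi> \<in> measurable M borel" "h \<in> borel_measurable M"
    "map_density M \<phi> \<in> borel_measurable M" "(\<lambda>x. x) \<in> measurable M borel"
    using \<phi> h map_density_measurable[OF M] by (auto intro: measurable_from_subalg[OF sub])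
  let ?D = "density M (map_density M \<phi>)"
  have "distr M borel \<phi> = distr ?D borel (\<lambda>x. x)"
  proof (rule measure_eqI)
    fix E assume "E \<in> sets (distr M borel \<phi>)"
    then have E: "E \<in> sets borel" by simp
    then show "emeasure (distr M borel \<phi>) E = emeasure (distr ?D borel (\<lambda>x. x)) E"
      using emeasure_vimage_eq_map_density[OF M \<phi> ns E] metric_measure_space_borel_sets[OF M E]
      by (simp add: emeasure_distr emeasure_density metric_measure_space_space[OF M])
  qed simp
  then have "(\<integral>\<^sup>+ x. h x \<partial>distr M borel \<phi>) = (\<integral>\<^sup>+ x. h x \<partial>distr ?D borel (\<lambda>x. x))"
    by simp
  then show ?thesis
    using h by (simp add: nn_integral_distr nn_integral_density)
qed

lemma modular_comp_le:
  fixes M :: "'a::metric_space measure"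
  assumes M: "metric_measure_space M" and p: "p \<in> borel_measurable borel"
    and \<phi>: "\<phi> \<in> borel_measurable borel" and ns: "nonsingular_map M \<phi>"
    and p_eq: "AE x in M. p x = p (\<phi> x)" and f: "f \<in> borel_measurable M"
    and c: "AE x in M. map_density M \<phi> x \<le> c"
  shows "(\<integral>\<^sup>+ x. ennreal (\<bar>f (\<phi> x)\<bar> powr p x) \<partial>M) \<le> c * modular M p f"
proof -
  note sub = metric_measure_space_subalgebra[OF M]
  obtain g N where g: "g \<in> borel_measurable borel" and N: "N \<in> sets borel" "emeasure M N = 0"
    and fg: "\<And>x. x \<notin> N \<Longrightarrow> f x = g x"
    using ex_borel_representative[OF M f] by blast
  define h where "h x = ennreal (\<bar>g x\<bar> powr p x)" for x
  have h: "h \<in> borel_measurable borel"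
    unfolding h_def using g p by measurable
  have hM: "h \<in> borel_measurable M"
    using measurable_from_subalg[OF sub h] .
  have "\<phi> -` N \<in> sets borel"
    using measurable_sets[OF \<phi> N(1)] by simp
  then have "\<phi> -` N \<in> null_sets M" "N \<in> null_sets M"
    using ns N by (auto simp: nonsingular_map_def null_sets_def
        intro: metric_measure_space_borel_sets[OF M])
  then have off: "AE x in M. \<phi> x \<notin> N" "AE x in M. x \<notin> N"
    by (auto dest: AE_not_in)
  have "(\<integral>\<^sup>+ x. ennreal (\<bar>f (\<phi> x)\<bar> powr p x) \<partial>M) = (\<integral>\<^sup>+ x. h (\<phi> x) \<partial>M)"
    using p_eq off(1) by (intro nn_integral_cong_AE) (auto simp: h_def fg)
  also have "\<dots> = (\<integral>\<^sup>+ x. map_density M \<phi> x * h x \<partial>M)"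
    by (rule nn_integral_comp_map_density[OF M \<phi> ns h])
  also have "\<dots> \<le> (\<integral>\<^sup>+ x. c * h x \<partial>M)"
    by (intro nn_integral_mono_AE eventually_mono[OF c] mult_right_mono) auto
  also have "\<dots> = c * (\<integral>\<^sup>+ x. h x \<partial>M)"
    using hM by (rule nn_integral_cmult)
  also have "(\<integral>\<^sup>+ x. h x \<partial>M) = modular M p f"
    unfolding modular_def using off(2) by (intro nn_integral_cong_AE) (auto simp: h_def fg)
  finally show ?thesis .
qed

section \<open>Necessity: testing on multiples of indicators\<close>

lemma test_inequality:
  fixes M :: "'a::metric_space measure" and p :: "'a \<Rightarrow> real"
  assumes M: "metric_measure_space M"
    and bound: "\<And>f. f \<in> Lp_var M p \<Longrightarrow>
      (\<integral>\<^sup>+ x. ennreal (\<bar>f (\<phi> x)\<bar> powr p x) \<partial>M) \<le> K * modular M p f"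
    and F: "F \<in> sets borel" "bounded F" and t: "t > 0"
  shows "(\<integral>\<^sup>+ x. ennreal (t powr p x) * indicator (\<phi> -` F) x \<partial>M)
    \<le> K * (\<integral>\<^sup>+ x. ennreal (t powr p x) * indicator F x \<partial>M)"
proof -
  define f where "f x = t * indicator F x" for x
  have FM: "F \<in> sets M"
    using metric_measure_space_borel_sets[OF M F(1)] .
  have "modular M p (\<lambda>x. f x / t) = (\<integral>\<^sup>+ x. indicator F x \<partial>M)"
    unfolding modular_def f_def using t
    by (intro nn_integral_cong) (auto simp: indicator_def)
  also have "\<dots> < \<infinity>"
    using metric_measure_space_bounded_finite[OF M F] FM by simp
  finally have "modular M p (\<lambda>x. f x / t) < \<infinity>" .
  moreover have "f \<in> borel_measurable M"
    unfolding f_def using FM by measurable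
  ultimately have "f \<in> Lp_var M p"
    using t by (auto simp: Lp_var_def)
  moreover have "ennreal (\<bar>f y\<bar> powr p x) = ennreal (t powr p x) * indicator F y" for x y
    using t by (simp add: f_def indicator_def)
  moreover have "indicator F (\<phi> x) = (indicator (\<phi> -` F) x :: ennreal)" for x
    by (simp add: indicator_def)
  ultimately show ?thesis
    using bound[of f] by (simp add: modular_def)
qed

lemma AE_by_balls:
  fixes x0 :: "'a::metric_space"
  assumes "\<And>n::nat. AE x in M. x \<in> ball x0 (real n) \<longrightarrow> P x"
  shows "AE x in M. P x"
proof -
  have "AE x in M. \<forall>n::nat. x \<in> ball x0 (real n) \<longrightarrow> P x"
    unfolding AE_all_countable using assms by blast
  then show ?thesis
  proof eventually_elim
    fix x assume "\<forall>n::nat. x \<in> ball x0 (real n) \<longrightarrow> P x"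
    moreover obtain n :: nat where "dist x0 x < real n"
      using reals_Archimedean2 by blast
    ultimately show "P x" by auto
  qed
qed

text \<open>
  On the set where the density exceeds \<open>C\<close>, the excess has integral zero: adding it to \<open>C\<close> times
  the measure of that set does not go beyond that same number. Cancelling needs the
  number to be finite, hence the intersection with balls.
\<close>

lemma map_density_le_const:
  fixes M :: "'a::metric_space measure"
  assumes M: "metric_measure_space M" and \<phi>: "\<phi> \<in> borel_measurable borel"
    and ns: "nonsingular_map M \<phi>"
    and bound: "\<And>F. F \<in> sets borel \<Longrightarrow> bounded F \<Longrightarrow>
      emeasure M (\<phi> -` F) \<le> ennreal C * emeasure M F"
  shows "AE x in M. map_density M \<phi> x \<le> ennreal C"
proof (rule AE_by_balls)
  fix n :: nat
  let ?u = "map_density M \<phi>"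
  note [measurable] = map_density_measurable[OF M, of \<phi>]
  define E where "E = {x. ennreal C < ?u x} \<inter> ball undefined (real n)"
  have "{x. ennreal C < ?u x} \<in> sets borel"
    by measurable
  then have E: "E \<in> sets borel" "bounded E"
    unfolding E_def by (auto intro: bounded_subset[OF bounded_ball])
  have EM[measurable]: "E \<in> sets M"
    using metric_measure_space_borel_sets[OF M E(1)] .
  have uM[measurable]: "?u \<in> borel_measurable M"
    by (rule measurable_from_subalg[OF metric_measure_space_subalgebra[OF M]]) measurable
  let ?I = "\<integral>\<^sup>+ x. (?u x - ennreal C) * indicator E x \<partial>M"
  have "ennreal C * emeasure M E + ?I
      = (\<integral>\<^sup>+ x. ennreal C * indicator E x + (?u x - ennreal C) * indicator E x \<partial>M)"
    by (simp add: nn_integral_add nn_integral_cmult)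
  also have "\<dots> = (\<integral>\<^sup>+ x\<in>E. ?u x \<partial>M)"
    by (intro nn_integral_cong) (auto simp: indicator_def E_def less_imp_le)
  also have "\<dots> \<le> ennreal C * emeasure M E"
    using bound[OF E] emeasure_vimage_eq_map_density[OF M \<phi> ns E(1)] by simp
  finally have "ennreal C * emeasure M E + ?I \<le> ennreal C * emeasure M E + 0"
    by simp
  moreover have "ennreal C * emeasure M E < \<infinity>"
    using metric_measure_space_bounded_finite[OF M E] by (auto simp: ennreal_mult_less_top)
  ultimately have "?I = 0"
    by (auto simp: ennreal_add_left_cancel_le)
  then have "AE x in M. (?u x - ennreal C) * indicator E x = 0"
    by (subst (asm) nn_integral_0_iff_AE) auto
  then show "AE x in M. x \<in> ball undefined (real n) \<longrightarrow> ?u x \<le> ennreal C"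
    by eventually_elim
      (auto simp: E_def indicator_def diff_eq_0_iff_ennreal not_less split: if_splits)
qed

lemma ennreal_eq_0_if_multiples_bounded:
  fixes a K :: ennreal
  assumes bounded: "\<And>\<tau>. \<tau> \<ge> 1 \<Longrightarrow> ennreal \<tau> * a \<le> K" and K: "K < \<infinity>"
  shows "a = 0"
proof (rule ccontr)
  assume a: "a \<noteq> 0"
  have "a \<le> K"
    using bounded[of 1] by simp
  with K have "a < \<infinity>"
    by (rule order.strict_trans1[rotated])
  with a obtain r where r: "a = ennreal r" "r > 0"
    by (cases a) (auto simp: less_le)
  obtain k where k: "K = ennreal k" "k \<ge> 0"
    using K by (cases K) auto
  have "ennreal ((k / r + 1) * r) \<le> ennreal k"
    using bounded[of "k / r + 1"] r k by (simp add: ennreal_mult)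
  then have "(k / r + 1) * r \<le> k"
    using k by simp
  also have "(k / r + 1) * r = k + r"
    using r by (simp add: distrib_right)
  finally show False
    using r by simp
qed

text \<open>
  The sign of \<open>\<alpha> - \<beta>\<close> covers both orderings at once: on \<open>A\<close> the exponent lies at or beyond \<open>\<alpha>\<close> as seen
  from \<open>\<beta>\<close>, and on \<open>F\<close> it lies at or beyond \<open>\<beta>\<close> as seen from \<open>\<alpha>\<close>. Testing with
  \<open>t = \<tau> powr (1 / (\<alpha> - \<beta>))\<close> where \<open>\<tau> \<ge> 1\<close> makes \<open>t\<close> large or small as required, and the ratio of
  \<open>t powr \<alpha>\<close> to \<open>t powr \<beta>\<close> is exactly \<open>\<tau>\<close>. So every multiple of the measure of \<open>A\<close> is bounded by
  one finite number.
\<close>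

lemma null_set_if_exponents_separated:
  fixes M :: "'a::metric_space measure" and p :: "'a \<Rightarrow> real"
  assumes M: "metric_measure_space M"
    and bound: "\<And>f. f \<in> Lp_var M p \<Longrightarrow>
      (\<integral>\<^sup>+ x. ennreal (\<bar>f (\<phi> x)\<bar> powr p x) \<partial>M) \<le> ennreal C * modular M p f"
    and F: "F \<in> sets borel" "bounded F" and A: "A \<in> sets borel" "A \<subseteq> \<phi> -` F"
    and "\<alpha> \<noteq> \<beta>"
    and pA: "\<And>x. x \<in> A \<Longrightarrow> 0 \<le> (\<alpha> - \<beta>) * (p x - \<alpha>)"
    and pF: "\<And>y. y \<in> F \<Longrightarrow> 0 \<le> (\<alpha> - \<beta>) * (\<beta> - p y)"
  shows "emeasure M A = 0"
proof (rule ennreal_eq_0_if_multiples_bounded)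
  show "ennreal C * emeasure M F < \<infinity>"
    using metric_measure_space_bounded_finite[OF M F] by (auto simp: ennreal_mult_less_top)
next
  fix \<tau> :: real assume \<tau>: "\<tau> \<ge> 1"
  define t where "t = \<tau> powr (1 / (\<alpha> - \<beta>))"
  have t: "t > 0"
    using \<tau> by (simp add: t_def)
  have t_mono: "t powr r \<le> t powr s" if "0 \<le> (\<alpha> - \<beta>) * (s - r)" for r s
  proof -
    have "r / (\<alpha> - \<beta>) \<le> s / (\<alpha> - \<beta>)"
      using that \<open>\<alpha> \<noteq> \<beta>\<close>
      by (cases "\<alpha> < \<beta>") (auto simp: zero_le_mult_iff divide_right_mono divide_right_mono_neg)
    then show ?thesis
      using \<tau> by (simp add: t_def powr_powr powr_mono)
  qed
  have ratio: "t powr \<alpha> = \<tau> * t powr \<beta>"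
  proof -
    have "t powr \<alpha> = t powr (\<alpha> - \<beta>) * t powr \<beta>"
      by (simp flip: powr_add)
    then show ?thesis
      using \<tau> \<open>\<alpha> \<noteq> \<beta>\<close> by (simp add: t_def powr_powr)
  qed
  have AM: "A \<in> sets M" and FM: "F \<in> sets M"
    using A F by (auto intro: metric_measure_space_borel_sets[OF M])
  have "ennreal (t powr \<beta>) * (ennreal \<tau> * emeasure M A) = ennreal (t powr \<alpha>) * emeasure M A"
    using \<tau> by (simp add: ratio ennreal_mult mult_ac)
  also have "\<dots> = (\<integral>\<^sup>+ x. ennreal (t powr \<alpha>) * indicator A x \<partial>M)"
    using AM by (simp add: nn_integral_cmult)
  also have "\<dots> \<le> (\<integral>\<^sup>+ x. ennreal (t powr p x) * indicator (\<phi> -` F) x \<partial>M)"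
    using A(2) by (intro nn_integral_mono) (auto simp: indicator_def intro!: ennreal_leI t_mono pA)
  also have "\<dots> \<le> ennreal C * (\<integral>\<^sup>+ x. ennreal (t powr p x) * indicator F x \<partial>M)"
    by (rule test_inequality[OF M bound F t])
  also have "\<dots> \<le> ennreal C * (\<integral>\<^sup>+ x. ennreal (t powr \<beta>) * indicator F x \<partial>M)"
    by (intro mult_left_mono nn_integral_mono)
      (auto simp: indicator_def intro!: ennreal_leI t_mono pF)
  also have "\<dots> = ennreal (t powr \<beta>) * (ennreal C * emeasure M F)"
    using FM by (simp add: nn_integral_cmult mult.left_commute)
  finally show "ennreal \<tau> * emeasure M A \<le> ennreal C * emeasure M F"
    using t by (subst (asm) ennreal_mult_le_mult_iff) auto
qed

text \<open>
  If \<open>p x\<close> and \<open>p (\<phi> x)\<close> differ, two rational numbers fit strictly between them, so the exceptional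
  set is a countable union of sets to which the previous lemma applies; the balls make \<open>F\<close> bounded.
\<close>

lemma exponent_invariant_if_modular_bound:
  fixes M :: "'a::metric_space measure" and p :: "'a \<Rightarrow> real"
  assumes M: "metric_measure_space M" and p: "p \<in> borel_measurable borel"
    and \<phi>: "\<phi> \<in> borel_measurable borel"
    and bound: "\<And>f. f \<in> Lp_var M p \<Longrightarrow>
      (\<integral>\<^sup>+ x. ennreal (\<bar>f (\<phi> x)\<bar> powr p x) \<partial>M) \<le> ennreal C * modular M p f"
  shows "AE x in M. p x = p (\<phi> x)"
proof -
  define F where "F \<alpha> \<beta> n = {y. 0 \<le> (\<alpha> - \<beta>) * (\<beta> - p y)} \<inter> ball undefined (real n)"
    for \<alpha> \<beta> and n :: nat
  define A where "A \<alpha> \<beta> n = {x. 0 \<le> (\<alpha> - \<beta>) * (p x - \<alpha>)} \<inter> \<phi> -` F \<alpha> \<beta> n"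
    for \<alpha> \<beta> and n :: nat
  have null: "AE x in M. x \<notin> A (of_rat a) (of_rat b) n" if "a \<noteq> b" for a b :: rat and n
  proof -
    let ?\<alpha> = "of_rat a :: real" and ?\<beta> = "of_rat b :: real"
    have "{y. 0 \<le> (?\<alpha> - ?\<beta>) * (?\<beta> - p y)} \<in> sets borel"
      using p by measurable
    then have F: "F ?\<alpha> ?\<beta> n \<in> sets borel" "bounded (F ?\<alpha> ?\<beta> n)"
      unfolding F_def by (auto intro: bounded_subset[OF bounded_ball])
    have "{x. 0 \<le> (?\<alpha> - ?\<beta>) * (p x - ?\<alpha>)} \<in> sets borel"
      using p by measurable
    moreover have "\<phi> -` F ?\<alpha> ?\<beta> n \<in> sets borel"
      using measurable_sets[OF \<phi> F(1)] by simp
    ultimately have A: "A ?\<alpha> ?\<beta> n \<in> sets borel"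
      unfolding A_def by blast
    have "emeasure M (A ?\<alpha> ?\<beta> n) = 0"
      by (rule null_set_if_exponents_separated[OF M bound F A, where \<alpha>="?\<alpha>" and \<beta>="?\<beta>"])
        (use that in \<open>auto simp: A_def F_def\<close>)
    then have "A ?\<alpha> ?\<beta> n \<in> null_sets M"
      using metric_measure_space_borel_sets[OF M A] by auto
    then show ?thesis
      by (rule AE_not_in)
  qed
  then have "AE x in M. \<forall>a b n. a \<noteq> b \<longrightarrow> x \<notin> A (of_rat a) (of_rat b) n"
    by (auto simp: AE_all_countable)
  then show ?thesis
  proof eventually_elim
    fix x assume notin: "\<forall>a b n. a \<noteq> b \<longrightarrow> x \<notin> A (of_rat a) (of_rat b) n"
    obtain n :: nat where n: "dist undefined (\<phi> x) < real n"
      using reals_Archimedean2 by blast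
    show "p x = p (\<phi> x)"
    proof (rule ccontr)
      assume "p x \<noteq> p (\<phi> x)"
      then consider "p (\<phi> x) < p x" | "p x < p (\<phi> x)" by linarith
      then show False
      proof cases
        case 1
        then obtain b where b: "p (\<phi> x) < of_rat b" "of_rat b < p x"
          using of_rat_dense by blast
        then obtain a where a: "(of_rat b :: real) < of_rat a" "of_rat a < p x"
          using of_rat_dense by blast
        have "x \<in> A (of_rat a) (of_rat b) n"
          using a b n by (auto simp: A_def F_def intro!: mult_nonneg_nonneg)
        moreover have "a \<noteq> b"
          using a(1) by auto
        ultimately show False
          using notin by blast
      next
        case 2
        then obtain b where b: "p x < of_rat b" "of_rat b < p (\<phi> x)"
          using of_rat_dense by blast
        then obtain a where a: "p x < of_rat a" "of_rat a < (of_rat b :: real)"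
          using of_rat_dense by blast
        have "x \<in> A (of_rat a) (of_rat b) n"
          using a b n by (auto simp: A_def F_def intro!: mult_nonpos_nonpos)
        moreover have "a \<noteq> b"
          using a(2) by auto
        ultimately show False
          using notin by blast
      qed
    qed
  qed
qed

section \<open>The equivalence\<close>

theorem theorem1:
  fixes M :: "'a::metric_space measure" and p :: "'a \<Rightarrow> real" and \<phi> :: "'a \<Rightarrow> 'a"
  assumes "metric_measure_space M"
    and "p \<in> exponents" and "exponent_sup M p < \<infinity>"
    and "\<phi> \<in> borel_measurable borel" and "nonsingular_map M \<phi>"
  shows "(\<exists>C::real. C > 0 \<and> (\<forall>f\<in>Lp_var M p.
            (\<integral>\<^sup>+ x. ennreal (\<bar>f (\<phi> x)\<bar> powr p x) \<partial>M)
              \<le> ennreal C * (\<integral>\<^sup>+ x. ennreal (\<bar>f x\<bar> powr p x) \<partial>M)))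
         \<longleftrightarrow> (esssup M (map_density M \<phi>) < \<infinity> \<and> (AE x in M. p x = p (\<phi> x)))"
proof -
  let ?M1 = "\<exists>C::real. C > 0 \<and> (\<forall>f\<in>Lp_var M p.
    (\<integral>\<^sup>+ x. ennreal (\<bar>f (\<phi> x)\<bar> powr p x) \<partial>M)
      \<le> ennreal C * (\<integral>\<^sup>+ x. ennreal (\<bar>f x\<bar> powr p x) \<partial>M))"
  let ?M2 = "esssup M (map_density M \<phi>) < \<infinity> \<and> (AE x in M. p x = p (\<phi> x))"
  have p: "p \<in> borel_measurable borel"
    using assms(2) by (simp add: exponents_def)
  note sub = metric_measure_space_subalgebra[OF assms(1)]
  have u: "map_density M \<phi> \<in> borel_measurable M"
    by (rule measurable_from_subalg[OF sub map_density_measurable[OF assms(1)]])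
  have ?M2 if ?M1
  proof -
    from that obtain C where bound: "\<And>f. f \<in> Lp_var M p \<Longrightarrow>
        (\<integral>\<^sup>+ x. ennreal (\<bar>f (\<phi> x)\<bar> powr p x) \<partial>M) \<le> ennreal C * modular M p f"
      by (auto simp: modular_def)
    have "emeasure M (\<phi> -` F) \<le> ennreal C * emeasure M F"
      if F: "F \<in> sets borel" "bounded F" for F
    proof -
      have "\<phi> -` F \<in> sets M" "F \<in> sets M"
        using measurable_sets[OF assms(4) F(1)] F(1)
        by (auto intro: metric_measure_space_borel_sets[OF assms(1)])
      then show ?thesis
        using test_inequality[OF assms(1) bound F, of 1] by simp
    qed
    then have "AE x in M. map_density M \<phi> x \<le> ennreal C"
      by (rule map_density_le_const[OF assms(1,4,5)])
    then have "esssup M (map_density M \<phi>) \<le> ennreal C"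
      using u by (intro esssup_I)
    then have "esssup M (map_density M \<phi>) < \<infinity>"
      by (rule order.strict_trans1) simp
    moreover have "AE x in M. p x = p (\<phi> x)"
      by (rule exponent_invariant_if_modular_bound[OF assms(1) p assms(4) bound])
    ultimately show ?M2 by blast
  qed
  moreover have ?M1 if R: ?M2
  proof -
    \<comment> \<open>The summand \<open>1\<close> keeps the constant positive when the essential supremum is \<open>0\<close>.\<close>
    define C where "C = enn2real (esssup M (map_density M \<phi>)) + 1"
    have le: "esssup M (map_density M \<phi>) \<le> ennreal C"
      using R by (cases "esssup M (map_density M \<phi>)") (auto simp: C_def intro!: ennreal_leI)
    have "AE x in M. map_density M \<phi> x \<le> ennreal C"
      using esssup_AE[of "map_density M \<phi>" M] le by (auto elim: eventually_mono)
    then have "(\<integral>\<^sup>+ x. ennreal (\<bar>f (\<phi> x)\<bar> powr p x) \<partial>M) \<le> ennreal C * modular M p f"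
      if "f \<in> Lp_var M p" for f
      using R that by (intro modular_comp_le[OF assms(1) p assms(4,5)]) (auto simp: Lp_var_def)
    moreover have "C > 0"
      unfolding C_def using enn2real_nonneg by (rule add_nonneg_pos) simp
    ultimately show ?M1
      by (auto simp: modular_def)
  qed
  ultimately show ?thesis by blast
qed

end
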